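(* For every integer $p$ with $2\le p\le 16$, the Burau representation of type $D_4$ over $\mathbb{Z}/p\mathbb{Z}$, i.e. the group homomorphism $\mathbf{B}(D_4)\to GL_4\big((\mathbb{Z}/p\mathbb{Z})[q,q^{-1}]\big)$ obtained from the Burau representation by reducing coefficients modulo $p$, is not faithful (has non-trivial kernel).
   Context: The Coxeter diagram $D_4$ has vertices $1,2,3,4$, with vertex $2$ adjacent to each of $1,3,4$ and no other edges; all edges are labelled $3$. The Artin--Tits group $\mathbf{B}(D_4)$ is generated by $\sigma_1,\dots,\sigma_4$ with relations $\sigma_i\sigma_j\sigma_i=\sigma_j\sigma_i\sigma_j$ if $i,j$ are adjacent and $\sigma_i\sigma_j=\sigma_j\sigma_i$ if $i\ne j$ are not adjacent. Burau representation over a ring $R=\mathbb{Z}$ or $R=\mathbb{Z}/p\mathbb{Z}$: on the free $R[q,q^{-1}]$-module with basis $\alpha_1,\dots,\alpha_4$, the generator $\sigma_i$ acts $R[q,q^{-1}]$-linearly by $\sigma_i(\alpha_i)=-q^2\alpha_i$, $\sigma_i(\alpha_j)=\alpha_j-q\alpha_i$ if $i,j$ are adjacent, and $\sigma_i(\alpha_j)=\alpha_j$ if $i\neq j$ are not adjacent. *)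

theory Defs
  imports
    "HOL-Analysis.Cartesian_Space"
    "HOL-Algebra.Coset"
    "HOL-Library.Poly_Mapping"
    "Berlekamp_Zassenhaus.Finite_Field"
begin

section \<open>Groups given by generators and relations\<close>

text \<open>A word is a list of letters; \<open>(g, True)\<close> stands for the generator \<open>g\<close> and
  \<open>(g, False)\<close> for its formal inverse. A relation \<open>l = r\<close> is a pair \<open>(l, r)\<close> of words.\<close>

type_synonym 'g word = "('g \<times> bool) list"

inductive_set pres_rel :: "('g word \<times> 'g word) set \<Rightarrow> ('g word \<times> 'g word) set"
  for R :: "('g word \<times> 'g word) set" where
  refl: "(u, u) \<in> pres_rel R"
| sym: "(u, v) \<in> pres_rel R \<Longrightarrow> (v, u) \<in> pres_rel R"
| trans: "(u, v) \<in> pres_rel R \<Longrightarrow> (v, w) \<in> pres_rel R \<Longrightarrow> (u, w) \<in> pres_rel R"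
| cancel: "(u @ [(g, b), (g, \<not> b)] @ v, u @ v) \<in> pres_rel R"
| relation: "(l, r) \<in> R \<Longrightarrow> (u @ l @ v, u @ r @ v) \<in> pres_rel R"

definition pres_class :: "('g word \<times> 'g word) set \<Rightarrow> 'g word \<Rightarrow> 'g word set" where
  "pres_class R w = pres_rel R `` {w}"

definition pres_group :: "('g word \<times> 'g word) set \<Rightarrow> 'g word set monoid" where
  "pres_group R =
     \<lparr>carrier = UNIV // pres_rel R,
      monoid.mult = (\<lambda>A B. \<Union>a\<in>A. \<Union>b\<in>B. pres_class R (a @ b)),
      monoid.one = pres_class R []\<rparr>"

fun word_eval :: "('h, 'm) monoid_scheme \<Rightarrow> ('g \<Rightarrow> 'h) \<Rightarrow> 'g word \<Rightarrow> 'h" where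
  "word_eval H f [] = \<one>\<^bsub>H\<^esub>"
| "word_eval H f ((g, b) # w) = (if b then f g else inv\<^bsub>H\<^esub> f g) \<otimes>\<^bsub>H\<^esub> word_eval H f w"

text \<open>The homomorphism out of a presented group determined by the images \<open>f\<close> of the generators;
  it is well defined when \<open>f\<close> satisfies the relations (\<open>pres_lift_hom\<close>, \<open>pres_lift_unique\<close> below).\<close>

definition pres_lift :: "('h, 'm) monoid_scheme \<Rightarrow> ('g \<Rightarrow> 'h) \<Rightarrow> 'g word set \<Rightarrow> 'h" where
  "pres_lift H f C = the_elem (word_eval H f ` C)"

lemma equiv_pres_rel: "equiv UNIV (pres_rel R)"
  by (intro equivI refl_onI symI transI)
     (auto intro: pres_rel.refl pres_rel.sym pres_rel.trans)

lemma pres_class_eq_iff: "pres_class R u = pres_class R v \<longleftrightarrow> (u, v) \<in> pres_rel R"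
  unfolding pres_class_def using equiv_pres_rel[of R] by (simp add: eq_equiv_class_iff)

lemma mem_pres_class: "v \<in> pres_class R u \<longleftrightarrow> (u, v) \<in> pres_rel R"
  by (simp add: pres_class_def)

lemma pres_rel_context:
  "(u, v) \<in> pres_rel R \<Longrightarrow> (x @ u @ y, x @ v @ y) \<in> pres_rel R"
proof (induction rule: pres_rel.induct)
  case (cancel u g b v)
  show ?case using pres_rel.cancel[of "x @ u" g b "v @ y" R] by simp
next
  case (relation l r u v)
  then show ?case using pres_rel.relation[of l r R "x @ u" "v @ y"] by simp
qed (auto intro: pres_rel.intros)

lemma pres_rel_append:
  assumes "(u, u') \<in> pres_rel R" "(v, v') \<in> pres_rel R"
  shows "(u @ v, u' @ v') \<in> pres_rel R"
  using pres_rel_context[OF assms(1), of "[]" v] pres_rel_context[OF assms(2), of u' "[]"]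
  by (auto intro: pres_rel.trans)

lemma pres_group_simps:
  "carrier (pres_group R) = range (pres_class R)"
  "\<one>\<^bsub>pres_group R\<^esub> = pres_class R []"
  by (auto simp: pres_group_def quotient_def pres_class_def)

lemma pres_group_mult:
  "pres_class R u \<otimes>\<^bsub>pres_group R\<^esub> pres_class R v = pres_class R (u @ v)"
proof -
  have "pres_class R (a @ b) = pres_class R (u @ v)"
    if "a \<in> pres_class R u" "b \<in> pres_class R v" for a b
    using that by (simp add: mem_pres_class pres_class_eq_iff pres_rel.sym pres_rel_append)
  moreover have "u \<in> pres_class R u" "v \<in> pres_class R v"
    by (simp_all add: mem_pres_class pres_rel.refl)
  ultimately have "(\<Union>a\<in>pres_class R u. \<Union>b\<in>pres_class R v. pres_class R (a @ b))
      = pres_class R (u @ v)"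
    by blast
  then show ?thesis by (simp add: pres_group_def)
qed

definition word_inv :: "'g word \<Rightarrow> 'g word" where
  "word_inv w = rev (map (\<lambda>(g, b). (g, \<not> b)) w)"

lemma word_inv_cancel: "(word_inv w @ w, []) \<in> pres_rel R"
proof (induction w)
  case (Cons a w)
  obtain g b where a: "a = (g, b)" by fastforce
  have "(word_inv w @ [(g, \<not> b), (g, \<not> \<not> b)] @ w, word_inv w @ w) \<in> pres_rel R"
    by (rule pres_rel.cancel)
  then show ?case using Cons.IH by (auto simp: a word_inv_def intro: pres_rel.trans)
qed (simp add: word_inv_def pres_rel.refl)

lemma group_pres_group: "group (pres_group R)"
proof (rule groupI)
  fix x assume "x \<in> carrier (pres_group R)"
  then obtain w where "x = pres_class R w" by (auto simp: pres_group_simps)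
  then show "\<exists>y\<in>carrier (pres_group R). y \<otimes>\<^bsub>pres_group R\<^esub> x = \<one>\<^bsub>pres_group R\<^esub>"
    by (auto simp: pres_group_simps pres_group_mult pres_class_eq_iff
        intro!: bexI[of _ "pres_class R (word_inv w)"] word_inv_cancel)
qed (auto simp: pres_group_simps pres_group_mult)

lemma word_eval_closed:
  assumes "group H" "\<And>g. f g \<in> carrier H"
  shows "word_eval H f w \<in> carrier H"
  using assms by (induction w) (auto simp: group.inv_closed group.is_monoid monoid.m_closed)

lemma word_eval_append:
  assumes "group H" "\<And>g. f g \<in> carrier H"
  shows "word_eval H f (u @ v) = word_eval H f u \<otimes>\<^bsub>H\<^esub> word_eval H f v"
proof -
  interpret group H by fact
  show ?thesis
    using assms by (induction u) (auto simp: word_eval_closed m_assoc)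
qed

lemma word_eval_pres_rel:
  assumes "group H" "\<And>g. f g \<in> carrier H"
    and "\<And>l r. (l, r) \<in> R \<Longrightarrow> word_eval H f l = word_eval H f r"
    and "(u, v) \<in> pres_rel R"
  shows "word_eval H f u = word_eval H f v"
proof -
  interpret group H by fact
  note closed = word_eval_closed[OF assms(1,2)]
  show ?thesis using assms(4)
  proof (induction rule: pres_rel.induct)
    case (cancel u g b v)
    have "word_eval H f [(g, b), (g, \<not> b)] = \<one>\<^bsub>H\<^esub>"
      using assms(2)[of g] by simp
    then show ?case
      by (simp only: word_eval_append[OF assms(1,2)] l_one closed)
  next
    case (relation l r u v)
    then show ?case by (simp add: word_eval_append[OF assms(1,2)] assms(3))
  qed auto
qed

context
  fixes H :: "('h, 'm) monoid_scheme" and f :: "'g \<Rightarrow> 'h" and R :: "('g word \<times> 'g word) set"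
  assumes H: "group H" and f: "\<And>g. f g \<in> carrier H"
    and R: "\<And>l r. (l, r) \<in> R \<Longrightarrow> word_eval H f l = word_eval H f r"
begin

lemma pres_lift_class: "pres_lift H f (pres_class R w) = word_eval H f w"
proof -
  have "word_eval H f v = word_eval H f w" if "v \<in> pres_class R w" for v
    using word_eval_pres_rel[of H f R w v] H f R that by (simp add: mem_pres_class)
  moreover have "w \<in> pres_class R w"
    by (simp add: mem_pres_class pres_rel.refl)
  ultimately have "word_eval H f ` pres_class R w = {word_eval H f w}"
    by blast
  then show ?thesis by (simp add: pres_lift_def)
qed

lemma pres_lift_hom: "pres_lift H f \<in> hom (pres_group R) H"
  by (auto intro!: homI simp: pres_group_simps pres_lift_class pres_group_mult
      word_eval_append[OF H f] word_eval_closed[OF H f])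

lemma pres_lift_gen: "pres_lift H f (pres_class R [(g, True)]) = f g"
proof -
  interpret group H by (rule H)
  show ?thesis by (simp add: pres_lift_class f)
qed

lemma pres_lift_unique:
  assumes h: "h \<in> hom (pres_group R) H"
    and gen: "\<And>g. h (pres_class R [(g, True)]) = f g"
    and C: "C \<in> carrier (pres_group R)"
  shows "h C = pres_lift H f C"
proof -
  interpret G: group "pres_group R" by (rule group_pres_group)
  interpret H: group H by (rule H)
  interpret h: group_hom "pres_group R" H h
    by (simp add: group_hom_def group_hom_axioms_def h G.group_axioms H.group_axioms)
  have inv: "pres_class R [(g, False)] = inv\<^bsub>pres_group R\<^esub> pres_class R [(g, True)]" for g
    using pres_rel.cancel[of "[]" g False "[]" R]
    by (intro G.inv_equality[symmetric])
       (auto simp: pres_group_mult pres_group_simps pres_class_eq_iff)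
  have letter: "h (pres_class R [(g, b)]) = (if b then f g else inv\<^bsub>H\<^esub> f g)" for g b
    by (cases b) (simp_all add: gen inv pres_group_simps)
  have "h (pres_class R w) = word_eval H f w" for w
  proof (induction w)
    case Nil
    show ?case using h.hom_one by (simp add: pres_group_simps)
  next
    case (Cons a w)
    obtain g b where a: "a = (g, b)" by fastforce
    have "pres_class R (a # w) = pres_class R [(g, b)] \<otimes>\<^bsub>pres_group R\<^esub> pres_class R w"
      by (simp add: a pres_group_mult)
    then have "h (pres_class R (a # w)) = h (pres_class R [(g, b)]) \<otimes>\<^bsub>H\<^esub> h (pres_class R w)"
      by (simp add: pres_group_simps)
    then show ?case by (simp add: a letter Cons.IH)
  qed
  then show ?thesis using C by (auto simp: pres_group_simps pres_lift_class)
qed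

end

section \<open>The Artin--Tits group of type $D_4$\<close>

text \<open>The vertices are \<open>1, 2, 3, 4 :: 4\<close>; in the numeral type \<open>4\<close> the last one equals \<open>0\<close>.\<close>

definition D4_adj :: "4 \<Rightarrow> 4 \<Rightarrow> bool" where
  "D4_adj i j \<longleftrightarrow> (i = 2 \<and> j \<in> {1, 3, 4}) \<or> (j = 2 \<and> i \<in> {1, 3, 4})"

definition artin_D4_relations :: "(4 word \<times> 4 word) set" where
  "artin_D4_relations =
     {([(i, True), (j, True), (i, True)], [(j, True), (i, True), (j, True)]) | i j. D4_adj i j} \<union>
     {([(i, True), (j, True)], [(j, True), (i, True)]) | i j. i \<noteq> j \<and> \<not> D4_adj i j}"

definition artin_D4 :: "4 word set monoid" where
  "artin_D4 = pres_group artin_D4_relations"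

definition artin_gen :: "4 \<Rightarrow> 4 word set" where
  "artin_gen i = pres_class artin_D4_relations [(i, True)]"

section \<open>The Burau representation\<close>

text \<open>Laurent polynomials $R[q,q^{-1}]$: finitely supported functions on the additive group
  of integers, with the convolution product of \<open>Poly_Mapping\<close>.\<close>

type_synonym 'a laurent = "int \<Rightarrow>\<^sub>0 'a"

definition lq :: "'a::comm_ring_1 laurent" where
  "lq = Poly_Mapping.single 1 1"

definition GL4 :: "('a::comm_ring_1 ^ 4 ^ 4) monoid" where
  "GL4 = \<lparr>carrier = {A. invertible A}, monoid.mult = (**), monoid.one = mat 1\<rparr>"

abbreviation alpha :: "4 \<Rightarrow> 'a::comm_ring_1 laurent ^ 4" where
  "alpha j \<equiv> axis j 1"

definition burau_action :: "4 \<Rightarrow> 4 \<Rightarrow> 'a::comm_ring_1 laurent ^ 4" where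
  "burau_action i j =
     (if j = i then (- (lq ^ 2)) *s alpha i
      else if D4_adj i j then alpha j - lq *s alpha i
      else alpha j)"

text \<open>Column \<open>j\<close> of the matrix of $\sigma_i$ is the coordinate vector of $\sigma_i(\alpha_j)$, so that
  the matrix product is composition of actions.\<close>

definition burau_gen :: "4 \<Rightarrow> 'a::comm_ring_1 laurent ^ 4 ^ 4" where
  "burau_gen i = (\<chi> k j. burau_action i j $ k)"

definition burau :: "4 word set \<Rightarrow> 'a::comm_ring_1 laurent ^ 4 ^ 4" where
  "burau = pres_lift GL4 burau_gen"

lemma group_artin_D4: "group artin_D4"
  by (simp add: artin_D4_def group_pres_group)

lemma group_GL4: "group (GL4 :: ('a::comm_ring_1 ^ 4 ^ 4) monoid)"
proof (rule groupI)
  fix A :: "'a ^ 4 ^ 4" assume "A \<in> carrier GL4"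
  then obtain B where "A ** B = mat 1" "B ** A = mat 1"
    by (auto simp: GL4_def invertible_def)
  then show "\<exists>B\<in>carrier GL4. B \<otimes>\<^bsub>GL4\<^esub> A = \<one>\<^bsub>GL4\<^esub>"
    by (auto simp: GL4_def invertible_def)
next
  fix A B :: "'a ^ 4 ^ 4"
  assume "A \<in> carrier GL4" "B \<in> carrier GL4"
  then obtain A' B' where AB: "A ** A' = mat 1" "A' ** A = mat 1" "B ** B' = mat 1" "B' ** B = mat 1"
    by (auto simp: GL4_def invertible_def)
  have "A ** B ** (B' ** A') = A ** (B ** B') ** A'" "B' ** A' ** (A ** B) = B' ** (A' ** A) ** B"
    by (simp_all only: matrix_mul_assoc)
  then have "A ** B ** (B' ** A') = mat 1" "B' ** A' ** (A ** B) = mat 1"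
    by (simp_all add: AB)
  then show "A \<otimes>\<^bsub>GL4\<^esub> B \<in> carrier GL4"
    by (auto simp: GL4_def invertible_def)
qed (auto simp: GL4_def invertible_def matrix_mul_assoc intro!: exI[of _ "mat 1"])

text \<open>Every \<open>burau_gen i\<close> differs from the identity matrix in row \<open>i\<close> only.\<close>

definition row_pert :: "4 \<Rightarrow> (4 \<Rightarrow> 'a) \<Rightarrow> 'a::comm_ring_1 ^ 4 ^ 4" where
  "row_pert i a = (\<chi> k l. (if k = l then 1 else 0) - (if k = i then a l else 0))"

definition burau_row :: "4 \<Rightarrow> 4 \<Rightarrow> 'a::comm_ring_1 laurent" where
  "burau_row i j = (if j = i then 1 + lq * lq else if D4_adj i j then lq else 0)"

lemma burau_gen_row_pert: "burau_gen i = row_pert i (burau_row i)"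
  by (auto simp: vec_eq_iff burau_gen_def row_pert_def burau_action_def burau_row_def axis_def
      power2_eq_square)

lemma row_pert_nth:
  "row_pert i a $ k $ l = (if k = l then 1 else 0) - (if k = i then a l else 0)"
  by (simp add: row_pert_def)

lemma row_pert_mult_nth:
  "(row_pert i a ** M) $ k $ l = M $ k $ l - (if k = i then \<Sum>m\<in>UNIV. a m * M $ m $ l else 0)"
proof -
  have "(row_pert i a ** M) $ k $ l
      = (\<Sum>m\<in>UNIV. (if k = m then M $ m $ l else 0) - (if k = i then a m * M $ m $ l else 0))"
    unfolding matrix_matrix_mult_def row_pert_def
    by (simp add: left_diff_distrib if_distrib[of "\<lambda>x. x * _"] cong: if_cong)
  then show ?thesis by (simp add: sum_subtractf)
qed

lemma row_pert_functional:
  "(\<Sum>m\<in>UNIV. a m * row_pert j b $ m $ l) = a l - a j * b l"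
proof -
  have "(\<Sum>m\<in>UNIV. a m * row_pert j b $ m $ l)
      = (\<Sum>m\<in>UNIV. (if m = l then a m else 0) - (if m = j then a m * b l else 0))"
    by (simp add: row_pert_def right_diff_distrib if_distrib[of "\<lambda>x. _ * x"] cong: if_cong)
  then show ?thesis by (simp add: sum_subtractf)
qed

lemma row_pert_mult2_nth:
  "(row_pert i a ** row_pert j b) $ k $ l = (if k = l then 1 else 0)
     - (if k = j then b l else 0) - (if k = i then a l - a j * b l else 0)"
  unfolding row_pert_mult_nth row_pert_functional by (simp only: row_pert_nth)

lemma row_pert_mult3_nth:
  "(row_pert i a ** (row_pert j b ** row_pert i c)) $ k $ l = (if k = l then 1 else 0)
     - (if k = i then c l else 0) - (if k = j then b l - b i * c l else 0)
     - (if k = i then a l - a i * c l - a j * (b l - b i * c l) else 0)"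
proof -
  have "(\<Sum>m\<in>UNIV. a m * (row_pert j b ** row_pert i c) $ m $ l)
      = (\<Sum>m\<in>UNIV. a m * row_pert i c $ m $ l - (if m = j then a m * (b l - b i * c l) else 0))"
    unfolding row_pert_mult_nth row_pert_functional
    by (simp add: right_diff_distrib if_distrib[of "\<lambda>x. _ * x"] cong: if_cong)
  then have "(\<Sum>m\<in>UNIV. a m * (row_pert j b ** row_pert i c) $ m $ l)
      = a l - a i * c l - a j * (b l - b i * c l)"
    by (simp add: sum_subtractf row_pert_functional)
  then show ?thesis
    by (simp only: row_pert_mult_nth[of i a] row_pert_mult2_nth)
qed

lemma burau_gen_GL4: "burau_gen i \<in> carrier (GL4 :: ('a::comm_ring_1 laurent ^ 4 ^ 4) monoid)"
proof -
  define r :: "'a laurent" where "r = Poly_Mapping.single (- 1) 1"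
  define b where "b l = r * r * burau_row i l" for l
  have q: "lq * r = 1" by (simp add: lq_def r_def mult_single)
  have "(1 + lq * lq) * (r * r) = r * r + (lq * r) * (lq * r)"
    by (simp add: algebra_simps)
  then have rr: "burau_row i i * (r * r) = r * r + 1"
    by (simp add: burau_row_def q)
  let ?p = "row_pert i (burau_row i) :: 'a laurent ^ 4 ^ 4"
  have "burau_row i i * b l = b l + burau_row i l" for l
  proof -
    have "burau_row i i * b l = (burau_row i i * (r * r)) * burau_row i l"
      by (simp add: b_def algebra_simps)
    then show ?thesis unfolding rr by (simp add: b_def algebra_simps)
  qed
  moreover have "b i * burau_row i l = b l + burau_row i l" for l
  proof -
    have "b i * burau_row i l = (burau_row i i * (r * r)) * burau_row i l"
      by (simp add: b_def algebra_simps)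
    then show ?thesis unfolding rr by (simp add: b_def algebra_simps)
  qed
  ultimately have "?p ** row_pert i b = mat 1" "row_pert i b ** ?p = mat 1"
    unfolding vec_eq_iff row_pert_mult2_nth by (auto simp: mat_def)
  then show ?thesis by (auto simp: GL4_def invertible_def burau_gen_row_pert)
qed

lemma burau_gen_braid:
  assumes "D4_adj i j"
  shows "(burau_gen i :: 'a::comm_ring_1 laurent ^ 4 ^ 4) ** (burau_gen j ** burau_gen i)
       = burau_gen j ** (burau_gen i ** burau_gen j)"
proof -
  have "i \<noteq> j" "D4_adj j i" using assms by (auto simp: D4_adj_def)
  then show ?thesis
    using assms unfolding vec_eq_iff burau_gen_row_pert row_pert_mult3_nth
    by (auto simp: burau_row_def[of i i] burau_row_def[of j j] burau_row_def[of i j]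
        burau_row_def[of j i] algebra_simps)
qed

lemma burau_gen_commute:
  assumes "i \<noteq> j" "\<not> D4_adj i j"
  shows "(burau_gen i :: 'a::comm_ring_1 laurent ^ 4 ^ 4) ** burau_gen j = burau_gen j ** burau_gen i"
proof -
  have "\<not> D4_adj j i" using assms by (auto simp: D4_adj_def)
  then show ?thesis
    using assms unfolding vec_eq_iff burau_gen_row_pert row_pert_mult2_nth
    by (auto simp: burau_row_def[of i j] burau_row_def[of j i])
qed

lemma burau_gen_relations:
  assumes "(l, r) \<in> artin_D4_relations"
  shows "word_eval GL4 (burau_gen :: 4 \<Rightarrow> 'a::comm_ring_1 laurent ^ 4 ^ 4) l = word_eval GL4 burau_gen r"
  using assms burau_gen_braid burau_gen_commute
  by (auto simp: artin_D4_relations_def GL4_def)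

lemma burau_hom: "burau \<in> hom artin_D4 (GL4 :: ('a::comm_ring_1 laurent ^ 4 ^ 4) monoid)"
  unfolding burau_def artin_D4_def
  by (rule pres_lift_hom[OF group_GL4 burau_gen_GL4 burau_gen_relations])

lemma burau_artin_gen: "burau (artin_gen i) = (burau_gen i :: 'a::comm_ring_1 laurent ^ 4 ^ 4)"
  unfolding burau_def artin_gen_def
  by (rule pres_lift_gen[OF group_GL4 burau_gen_GL4 burau_gen_relations])

lemma burau_unique:
  fixes h :: "4 word set \<Rightarrow> 'a::comm_ring_1 laurent ^ 4 ^ 4"
  assumes "h \<in> hom artin_D4 GL4" "\<And>i. h (artin_gen i) = burau_gen i" "C \<in> carrier artin_D4"
  shows "h C = burau C"
  using assms unfolding burau_def artin_D4_def artin_gen_def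
  by (intro pres_lift_unique[OF group_GL4 burau_gen_GL4 burau_gen_relations]) auto

subsection \<open>Reduction of coefficients\<close>

text \<open>The ring of integers modulo \<open>p\<close> is \<open>'p mod_ring\<close> with \<open>CARD('p) = p\<close>; \<open>burau_eq_reduction\<close>
  says that the Burau representation over it is the integral one with reduced coefficients.\<close>

definition reduce_laurent :: "int laurent \<Rightarrow> 'a::comm_ring_1 laurent" where
  "reduce_laurent f = Poly_Mapping.map of_int f"

definition reduce_matrix :: "int laurent ^ 4 ^ 4 \<Rightarrow> 'a::comm_ring_1 laurent ^ 4 ^ 4" where
  "reduce_matrix A = (\<chi> i j. reduce_laurent (A $ i $ j))"

lemma lookup_reduce_laurent:
  "Poly_Mapping.lookup (reduce_laurent f :: 'a::comm_ring_1 laurent) k = of_int (Poly_Mapping.lookup f k)"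
  by (simp add: reduce_laurent_def Poly_Mapping.map.rep_eq when_def)

lemma reduce_laurent_linear:
  "reduce_laurent (f + g) = reduce_laurent f + reduce_laurent g"
  "reduce_laurent (f - g) = reduce_laurent f - reduce_laurent g"
  "reduce_laurent (- f) = - reduce_laurent f"
  "reduce_laurent 0 = 0"
  by (auto intro!: poly_mapping_eqI simp: lookup_reduce_laurent lookup_add lookup_minus)

lemma reduce_laurent_single:
  "reduce_laurent (Poly_Mapping.single k c) = Poly_Mapping.single k (of_int c)"
  by (rule poly_mapping_eqI) (simp add: lookup_reduce_laurent lookup_single when_def)

lemma reduce_laurent_mult:
  "reduce_laurent (f * g) = (reduce_laurent f * reduce_laurent g :: 'a::comm_ring_1 laurent)"
proof -
  have single: "reduce_laurent (Poly_Mapping.single a 1 * g)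
      = (reduce_laurent (Poly_Mapping.single a 1) * reduce_laurent g :: 'a laurent)" for a
    using subset_UNIV[of "Poly_Mapping.keys g"]
    by (induction g rule: frag_induction)
       (auto simp: reduce_laurent_linear reduce_laurent_single mult_single right_diff_distrib)
  show ?thesis
    using subset_UNIV[of "Poly_Mapping.keys f"]
    by (induction f rule: frag_induction)
       (auto simp: reduce_laurent_linear single left_diff_distrib)
qed

lemma reduce_laurent_one: "reduce_laurent 1 = 1"
  using reduce_laurent_single[of 0 1] by simp

lemma reduce_laurent_lq: "reduce_laurent lq = lq"
  by (simp add: lq_def reduce_laurent_single)

lemma reduce_matrix_mult: "reduce_matrix (A ** B) = reduce_matrix A ** reduce_matrix B"
  by (simp add: reduce_matrix_def vec_eq_iff matrix_matrix_mult_def sum_4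
      reduce_laurent_linear reduce_laurent_mult)

lemma reduce_matrix_one: "reduce_matrix (mat 1) = mat 1"
  by (simp add: reduce_matrix_def vec_eq_iff mat_def reduce_laurent_linear reduce_laurent_one)

lemma reduce_matrix_burau_gen: "reduce_matrix (burau_gen i) = burau_gen i"
  by (simp add: reduce_matrix_def vec_eq_iff burau_gen_def burau_action_def axis_def
      power2_eq_square reduce_laurent_linear reduce_laurent_one reduce_laurent_mult
      reduce_laurent_lq)

lemma burau_eq_reduction:
  assumes "C \<in> carrier artin_D4"
  shows "burau C = (reduce_matrix (burau C) :: 'a::comm_ring_1 laurent ^ 4 ^ 4)"
proof (rule burau_unique[symmetric, OF _ _ assms])
  have "reduce_matrix \<in> hom GL4 (GL4 :: ('a laurent ^ 4 ^ 4) monoid)"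
    by (intro homI)
       (auto simp: GL4_def invertible_def reduce_matrix_mult, 
        metis reduce_matrix_mult reduce_matrix_one)
  then show "(\<lambda>C. reduce_matrix (burau C)) \<in> hom artin_D4 (GL4 :: ('a laurent ^ 4 ^ 4) monoid)"
    using hom_compose[OF burau_hom] by (auto simp: o_def)
  show "reduce_matrix (burau (artin_gen i)) = (burau_gen i :: 'a laurent ^ 4 ^ 4)" for i
    by (simp add: burau_artin_gen reduce_matrix_burau_gen)
qed

end

(* Write z for the conjugate w s_2 w^-1 of s_2 = \<sigma>_2. In the Burau representation s_2 and z act as
   v - \<phi>(v) \<alpha>_2 and v - \<psi>(v) \<beta>, where \<beta> = w \<alpha>_2, and they satisfy the braid relation
   z s_2 z = s_2 z s_2 as soon as \<phi>(\<beta>) \<psi>(\<alpha>_2) = q^2. Over the integers the relation forces this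
   product to be q^2 or (1 + q^2)^2. So a word w for which the integral product is neither of these,
   but reduces to q^2 modulo P, gives an element of the kernel modulo P that is detected by the
   integral representation. For each P from 9 to 16 a computer search found such a word; every p
   from 2 to 16 divides one of these P. *)

theory Submission
  imports Defs
begin

section \<open>Kernel elements from words\<close>

text \<open>The class of u v^-1 is killed over \<open>'a\<close>, where u and v have the same image.
  It is not the identity: words equal in the group have equal images over every coefficient ring,
  and over \<open>'b\<close> they differ.\<close>

lemma kernel_burau_nontrivial:
  assumes eq: "word_eval GL4 (burau_gen :: 4 \<Rightarrow> 'a::comm_ring_1 laurent ^ 4 ^ 4) u
      = word_eval GL4 burau_gen v"
    and neq: "word_eval GL4 (burau_gen :: 4 \<Rightarrow> 'b::comm_ring_1 laurent ^ 4 ^ 4) u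
      \<noteq> word_eval GL4 burau_gen v"
  shows "kernel artin_D4 GL4 (burau :: 4 word set \<Rightarrow> 'a laurent ^ 4 ^ 4) \<noteq> {\<one>\<^bsub>artin_D4\<^esub>}"
proof -
  define C where "C = pres_class artin_D4_relations (u @ word_inv v)"
  let ?A = "GL4 :: ('a laurent ^ 4 ^ 4) monoid"
  note appA = word_eval_append[OF group_GL4 burau_gen_GL4]
  \<comment> \<open>\<open>word_inv\<close> is an involution, so left cancellation for
    \<open>word_inv v\<close> is right cancellation for \<open>v\<close>.\<close>
  have "word_eval ?A burau_gen (v @ word_inv v) = \<one>\<^bsub>?A\<^esub>"
    using word_eval_pres_rel[OF group_GL4 burau_gen_GL4 burau_gen_relations word_inv_cancel[of "word_inv v"]]
    by (simp add: word_inv_def rev_map o_def case_prod_unfold)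
  then have "burau C = \<one>\<^bsub>?A\<^esub>"
    unfolding C_def burau_def
    by (simp add: pres_lift_class[OF group_GL4 burau_gen_GL4 burau_gen_relations] appA eq)
  then have "C \<in> kernel artin_D4 ?A burau"
    by (simp add: C_def kernel_def artin_D4_def pres_group_simps)
  moreover have "C \<noteq> \<one>\<^bsub>artin_D4\<^esub>"
  proof
    assume "C = \<one>\<^bsub>artin_D4\<^esub>"
    then have "(u @ word_inv v, []) \<in> pres_rel artin_D4_relations"
      by (simp add: C_def artin_D4_def pres_group_simps pres_class_eq_iff)
    from pres_rel_context[OF this, of "[]" v]
    have "(u @ word_inv v @ v, v) \<in> pres_rel artin_D4_relations" by simp
    moreover have "(u @ word_inv v @ v, u) \<in> pres_rel artin_D4_relations"
      using pres_rel_context[OF word_inv_cancel, of u v "[]"] by simp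
    ultimately have "(u, v) \<in> pres_rel artin_D4_relations"
      by (meson pres_rel.sym pres_rel.trans)
    from word_eval_pres_rel[OF group_GL4 burau_gen_GL4 burau_gen_relations this] neq
    show False by blast
  qed
  ultimately show ?thesis by blast
qed

section \<open>Two reflections and the braid relation\<close>

lemma matrix_vector_mult_smult: "A *v (c *s v) = c *s (A *v v)" for A :: "'a::comm_ring_1 ^ 'n ^ 'm"
  by (simp add: matrix_vector_mult_def vec_eq_iff sum_distrib_left algebra_simps)

text \<open>Put A = 1 - S, B = 1 - Z and x = \<open>\<phi> \<beta> * \<psi> \<gamma>\<close>. Then
  A^2 = (1 + t) A, B^2 = (1 + t) B, A B A = x A and B A B = x B. In the difference AB + BA cancels,
  leaving (x - t) (A - B).\<close>

lemma reflections_braid_diff: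
  fixes \<phi> \<psi> :: "'a::comm_ring_1 ^ 'n \<Rightarrow> 'a"
  assumes \<phi>: "\<And>v w. \<phi> (v - w) = \<phi> v - \<phi> w" "\<And>c v. \<phi> (c *s v) = c * \<phi> v" "\<phi> \<gamma> = 1 + t"
    and \<psi>: "\<And>v w. \<psi> (v - w) = \<psi> v - \<psi> w" "\<And>c v. \<psi> (c *s v) = c * \<psi> v" "\<psi> \<beta> = 1 + t"
    and S: "\<And>v. S v = v - \<phi> v *s \<gamma>" and Z: "\<And>v. Z v = v - \<psi> v *s \<beta>"
  shows "Z (S (Z v)) - S (Z (S v)) = (\<phi> \<beta> * \<psi> \<gamma> - t) *s (\<phi> v *s \<gamma> - \<psi> v *s \<beta>)"
  unfolding S Z \<phi> \<psi> by (simp add: vec_eq_iff algebra_simps)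

section \<open>Laurent polynomials in $q^2$ as coefficient lists\<close>

text \<open>Lowest degree first. A list has a value over every coefficient ring, so one integer
  computation serves both the integers and the reduction modulo P.\<close>

abbreviation lpol :: "int list \<Rightarrow> 'a::comm_ring_1 laurent" where
  "lpol \<equiv> horner_sum of_int (lq * lq)"

fun ladd :: "int list \<Rightarrow> int list \<Rightarrow> int list" where
  "ladd [] ys = ys"
| "ladd xs [] = xs"
| "ladd (x # xs) (y # ys) = (x + y) # ladd xs ys"

definition lneg :: "int list \<Rightarrow> int list" where
  "lneg = map uminus"

fun lmul :: "int list \<Rightarrow> int list \<Rightarrow> int list" where
  "lmul [] ys = []"
| "lmul (x # xs) ys = ladd (map ((*) x) ys) (0 # lmul xs ys)"

lemma lpol_ladd: "lpol (ladd xs ys) = lpol xs + lpol ys"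
  by (induction xs ys rule: ladd.induct) (auto simp: algebra_simps)

lemma lpol_lneg: "lpol (lneg xs) = - lpol xs"
  by (induction xs) (auto simp: lneg_def)

lemma lpol_lmul: "lpol (lmul xs ys) = lpol xs * lpol ys"
proof -
  have "lpol (map ((*) x) ys) = of_int x * (lpol ys :: 'a laurent)" for x
    by (induction ys) (auto simp: algebra_simps)
  then show ?thesis
    by (induction xs) (auto simp: lpol_ladd algebra_simps)
qed

lemma lpol_shift: "lpol (replicate n 0 @ xs) = (lq * lq) ^ n * lpol xs"
  by (induction n) (auto simp: algebra_simps)

lemma lookup_lpol:
  "Poly_Mapping.lookup (lpol xs :: 'a::comm_ring_1 laurent) (2 * int n)
     = (if n < length xs then of_int (xs ! n) else 0)"
proof -
  have "lq * lq = (Poly_Mapping.single 2 1 :: 'a laurent)"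
    by (simp add: lq_def mult_single)
  then have "(lq * lq) ^ i = (Poly_Mapping.single (2 * int i) 1 :: 'a laurent)" for i
    by (induction i) (auto simp: mult_single)
  then have "(lpol xs :: 'a laurent) = (\<Sum>i<length xs. Poly_Mapping.single (2 * int i) (of_int (xs ! i)))"
    unfolding horner_sum_eq_sum by (intro sum.cong) (auto simp: mult_single simp flip: single_of_int)
  then show ?thesis
    by (simp add: lookup_sum lookup_single when_def)
qed

text \<open>Lists may carry trailing zeros, so vanishing is tested entry by entry and not by
  comparison with \<open>[]\<close>.\<close>

lemma lpol_nonzero:
  assumes "\<not> list_all ((=) 0) xs"
  shows "(lpol xs :: int laurent) \<noteq> 0"
proof -
  obtain n where "n < length xs" "xs ! n \<noteq> 0"
    using assms by (auto simp: list_all_length)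
  then show ?thesis
    using lookup_lpol[where 'a = int, of xs n] by auto
qed

lemma lpol_eq_0:
  assumes "list_all (\<lambda>x. (of_int x :: 'a::comm_ring_1) = 0) xs"
  shows "(lpol xs :: 'a laurent) = 0"
  using assms by (induction xs) (auto simp flip: single_of_int)

section \<open>Executable action of words on a root\<close>

abbreviation bmat :: "4 word \<Rightarrow> 'a::comm_ring_1 laurent ^ 4 ^ 4" where
  "bmat \<equiv> word_eval GL4 burau_gen"

text \<open>The form \<phi> for which \<sigma>_2 is v - \<phi>(v) \<alpha>_2.\<close>

definition root_form :: "'a::comm_ring_1 laurent ^ 4 \<Rightarrow> 'a laurent" where
  "root_form v = (\<Sum>m\<in>UNIV. burau_row 2 m * v $ m)"

lemma GL4_mult: "A \<otimes>\<^bsub>GL4\<^esub> B = A ** B"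
  by (simp add: GL4_def)

lemma GL4_one: "\<one>\<^bsub>GL4\<^esub> = mat 1"
  by (simp add: GL4_def)

lemma bmat_eq: "(u, v) \<in> pres_rel artin_D4_relations \<Longrightarrow> bmat u = bmat v"
  by (rule word_eval_pres_rel[OF group_GL4 burau_gen_GL4 burau_gen_relations])

lemma bmat_append: "bmat (u @ v) = bmat u ** bmat v"
  by (simp only: word_eval_append[OF group_GL4 burau_gen_GL4] GL4_mult)

lemma bmat_gen: "bmat [(i, True)] = burau_gen i"
  by (simp add: GL4_def)

lemma bmat_Cons: "bmat (x # w) = bmat [x] ** bmat w"
  using bmat_append[of "[x]" w] by simp

lemma bmat_cancel: "bmat [(i, b)] ** bmat [(i, \<not> b)] = mat 1"
proof -
  have "bmat [(i, b)] ** bmat [(i, \<not> b)] = bmat ([] @ [(i, b), (i, \<not> b)] @ [])"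
    by (simp only: bmat_append[symmetric] append.simps)
  also have "\<dots> = bmat ([] @ [])"
    by (rule bmat_eq) (rule pres_rel.cancel)
  finally show ?thesis by (simp add: GL4_one)
qed

lemma bmat_inv:
  "bmat (word_inv w) ** bmat w = mat 1" "bmat w ** bmat (word_inv w) = mat 1"
proof -
  show left: "bmat (word_inv w) ** bmat w = mat 1" for w
    using bmat_eq[OF word_inv_cancel[of w]] by (simp add: bmat_append GL4_one)
  have "word_inv (word_inv w) = w"
    by (simp add: word_inv_def rev_map o_def case_prod_unfold)
  then show "bmat w ** bmat (word_inv w) = mat 1"
    using left[of "word_inv w"] by simp
qed

lemma burau_gen_vec:
  "burau_gen i *v v = v - (\<Sum>m\<in>UNIV. burau_row i m * v $ m) *s axis i 1"
proof -
  have "(burau_gen i *v v) $ k = v $ k - (if k = i then \<Sum>m\<in>UNIV. burau_row i m * v $ m else 0)" for k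
  proof -
    have "(burau_gen i *v v) $ k
        = (\<Sum>m\<in>UNIV. (if k = m then v $ m else 0) - (if k = i then burau_row i m * v $ m else 0))"
      unfolding matrix_vector_mult_def burau_gen_row_pert row_pert_def
      by (simp add: left_diff_distrib if_distrib[of "\<lambda>x. x * _"] cong: if_cong)
    then show ?thesis by (simp add: sum_subtractf)
  qed
  then show ?thesis by (auto simp: vec_eq_iff axis_def)
qed

text \<open>Signed integers make inversion of a word into reversal with negation. This fails for 0,
  which is sent to an inverse letter and equals its own negative.\<close>

definition letter :: "int \<Rightarrow> 4 \<times> bool" where
  "letter k = (if \<bar>k\<bar> = 1 then 1 else if \<bar>k\<bar> = 2 then 2 else if \<bar>k\<bar> = 3 then 3 else 4, 0 < k)"

type_synonym coords = "nat \<times> int list \<times> int list \<times> int list \<times> int list"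

text \<open>In the basis $q\alpha_1, \alpha_2, q\alpha_3, q\alpha_4$ the generators have entries in
  $\mathbb{Z}[q^2]$ and their inverses in $q^{-2}\mathbb{Z}[q^2]$; the first component of the
  coordinates is the power of $q^{-2}$ taken out.\<close>

definition vec_of :: "coords \<Rightarrow> 'a::comm_ring_1 laurent ^ 4" where
  "vec_of = (\<lambda>(n, a, b, c, d). (\<chi> i. Poly_Mapping.single (-2) 1 ^ n *
     (if i = 2 then lpol b else lq * lpol (if i = 1 then a else if i = 3 then c else d))))"

text \<open>A negative letter takes out one more q^-2, so the coordinates that it fixes are
  multiplied by q^2, a leading 0.\<close>

fun act :: "int \<Rightarrow> coords \<Rightarrow> coords" where
  "act k (n, a, b, c, d) =
    (if 0 < k then
       if \<bar>k\<bar> = 1 then (n, lneg (ladd (0 # a) b), b, c, d)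
       else if \<bar>k\<bar> = 2 then (n, a, lneg (0 # ladd b (ladd a (ladd c d))), c, d)
       else if \<bar>k\<bar> = 3 then (n, a, b, lneg (ladd (0 # c) b), d)
       else (n, a, b, c, lneg (ladd (0 # d) b))
     else
       if \<bar>k\<bar> = 1 then (Suc n, lneg (ladd a b), 0 # b, 0 # c, 0 # d)
       else if \<bar>k\<bar> = 2 then (Suc n, 0 # a, lneg (ladd b (0 # ladd a (ladd c d))), 0 # c, 0 # d)
       else if \<bar>k\<bar> = 3 then (Suc n, 0 # a, 0 # b, lneg (ladd c b), 0 # d)
       else (Suc n, 0 # a, 0 # b, 0 # c, lneg (ladd d b)))"

definition run :: "int list \<Rightarrow> coords" where
  "run ks = foldr act ks (0, [], [1], [], [])"

text \<open>Up to the power of q^-2 this is (1 + q^2) b + q (q a + q c + q d), the value of \<phi>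
  in the rescaled basis.\<close>

fun form_coeffs :: "coords \<Rightarrow> int list" where
  "form_coeffs (n, a, b, c, d) = ladd b (0 # ladd b (ladd a (ladd c d)))"

lemma lq_inverse: "Poly_Mapping.single (-2) 1 * (lq * lq) = (1 :: 'a::comm_ring_1 laurent)"
  by (simp add: lq_def mult_single)

lemma D4_adj_simps [simp]:
  "D4_adj 1 2" "D4_adj 2 1" "D4_adj 3 2" "D4_adj 2 3" "D4_adj 4 2" "D4_adj 2 4"
  "\<not> D4_adj 1 3" "\<not> D4_adj 3 1" "\<not> D4_adj 1 4" "\<not> D4_adj 4 1" "\<not> D4_adj 3 4" "\<not> D4_adj 4 3"
  by (auto simp: D4_adj_def)

lemma act_correct: "bmat [letter k] *v vec_of s = vec_of (act k s)"
proof -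
  obtain n a b c d where s: "s = (n, a, b, c, d)" by (cases s)
  define i where "i = fst (letter k)"
  define R :: "'a laurent" where "R = Poly_Mapping.single (-2) 1"
  \<comment> \<open>q^2 absorbs one of the \<open>Suc n\<close> factors q^-2; the nested products
    are the form in which simplification meets them.\<close>
  have R: "lq * (lq * (x * R ^ Suc n)) = x * R ^ n" "lq * (lq * (lq * (x * R ^ Suc n))) = lq * (x * R ^ n)" for x
  proof -
    have "lq * (lq * (x * R ^ Suc n)) = x * R ^ n * (R * (lq * lq))" for x
      by (simp add: algebra_simps)
    then show "lq * (lq * (x * R ^ Suc n)) = x * R ^ n" "lq * (lq * (lq * (x * R ^ Suc n))) = lq * (x * R ^ n)" for x
      by (simp_all add: R_def lq_inverse)
  qed
  show ?thesis
  proof (cases "0 < k")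
    case True
    then show ?thesis
      unfolding s
      by (auto simp: letter_def bmat_gen burau_gen_vec vec_eq_iff forall_4 sum_4 vec_of_def axis_def
          burau_row_def lpol_ladd lpol_lneg algebra_simps simp del: word_eval.simps)
  next
    case False
    then have letter: "letter k = (i, False)"
      by (simp add: i_def letter_def)
    \<comment> \<open>No matrix of the inverse generator is computed: \<sigma>_i takes
      \<open>act k s\<close> back to \<open>s\<close>, and multiplying by the inverse of \<sigma>_i
      gives the claim.\<close>
    have "burau_gen i *v vec_of (act k s) = (vec_of s :: 'a laurent ^ 4)"
      using False unfolding s i_def
      by (auto simp: letter_def R[unfolded R_def] burau_gen_vec vec_eq_iff forall_4 sum_4 vec_of_def axis_def
          burau_row_def lpol_ladd lpol_lneg algebra_simps simp del: word_eval.simps power_Suc)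
    then have "bmat [(i, False)] *v (bmat [(i, True)] *v vec_of (act k s)) = bmat [(i, False)] *v (vec_of s :: 'a laurent ^ 4)"
      by (simp only: bmat_gen)
    moreover have "bmat [(i, False)] ** bmat [(i, True)] = (mat 1 :: 'a laurent ^ 4 ^ 4)"
      using bmat_cancel[of i False] by (simp del: word_eval.simps)
    ultimately show ?thesis
      by (simp add: letter matrix_vector_mul_assoc del: word_eval.simps)
  qed
qed

lemma run_correct: "bmat (map letter ks) *v alpha 2 = vec_of (run ks)"
proof (induction ks)
  case Nil
  show ?case
    by (auto simp: run_def vec_of_def vec_eq_iff GL4_one axis_def)
next
  case (Cons k ks)
  show ?case
    by (simp only: list.map bmat_Cons[of "letter k" "map letter ks"] matrix_vector_mul_assoc[symmetric]
        Cons.IH act_correct) (simp add: run_def)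
qed

lemma root_form_vec_of:
  "root_form (vec_of s) = Poly_Mapping.single (-2) 1 ^ fst s * lpol (form_coeffs s)"
  by (cases s) (simp add: root_form_def vec_of_def sum_4 burau_row_def lpol_ladd algebra_simps)

section \<open>The braid relation between \<sigma>_2 and its conjugate z\<close>

text \<open>For the word w of \<open>ks\<close> this is \<phi>(w \<alpha>_2) = \<phi>(\<beta>); for
  the list of w^-1 it is \<phi>(w^-1 \<alpha>_2) = \<psi>(\<alpha>_2).\<close>

definition pairing :: "int list \<Rightarrow> 'a::comm_ring_1 laurent" where
  "pairing ks = root_form (vec_of (run ks))"

text \<open>By \<open>reflections_braid_diff\<close> with t = q^2 the two sides differ by a multiple
  of x - q^2. The first claim serves coefficients in which P vanishes, the second the
  integers.\<close>

lemma braid_relation_pairing: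
  fixes ks :: "int list"
  assumes ks: "0 \<notin> set ks"
  defines "z \<equiv> map letter ks @ [(2, True)] @ word_inv (map letter ks)"
    and "x \<equiv> pairing ks * pairing (rev (map uminus ks)) :: 'a::comm_ring_1 laurent"
  shows "x = lq * lq \<Longrightarrow> (bmat (z @ [(2, True)] @ z) :: 'a laurent ^ 4 ^ 4) = bmat ([(2, True)] @ z @ [(2, True)])"
    and "(bmat (z @ [(2, True)] @ z) :: 'a laurent ^ 4 ^ 4) = bmat ([(2, True)] @ z @ [(2, True)])
       \<Longrightarrow> (x - lq * lq) * ((1 + lq * lq)\<^sup>2 - x) = 0"
proof -
  define w where "w = map letter ks"
  have inv: "word_inv w = map letter (rev (map uminus ks))"
    using ks unfolding w_def by (induction ks) (auto simp: word_inv_def letter_def)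
  define \<phi> where "\<phi> = (root_form :: 'a laurent ^ 4 \<Rightarrow> _)"
  \<comment> \<open>Conjugation by w carries the form \<phi> to \<phi> composed with w^-1, and the
    root \<alpha>_2 to \<beta>.\<close>
  define \<psi> where "\<psi> v = \<phi> (bmat (word_inv w) *v v)" for v
  define \<beta> where "\<beta> = (bmat w *v alpha 2 :: 'a laurent ^ 4)"
  define S where "S v = burau_gen 2 *v v" for v :: "'a laurent ^ 4"
  define Z where "Z v = bmat z *v v" for v :: "'a laurent ^ 4"
  have \<phi>: "\<phi> (v - v') = \<phi> v - \<phi> v'" "\<phi> (c *s v) = c * \<phi> v" "\<phi> (alpha 2) = 1 + lq * lq" for v v' c
    by (simp_all add: \<phi>_def root_form_def sum_4 burau_row_def axis_def algebra_simps)
  have inv_\<beta>: "bmat (word_inv w) *v \<beta> = alpha 2"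
    by (simp add: \<beta>_def matrix_vector_mul_assoc bmat_inv)
  have \<psi>: "\<psi> (v - v') = \<psi> v - \<psi> v'" "\<psi> (c *s v) = c * \<psi> v" "\<psi> \<beta> = 1 + lq * lq" for v v' c
    by (simp_all add: \<psi>_def \<phi> inv_\<beta> matrix_vector_mult_diff_distrib matrix_vector_mult_smult)
  have S: "S v = v - \<phi> v *s alpha 2" for v
    by (simp add: S_def burau_gen_vec \<phi>_def root_form_def)
  have Z: "Z v = v - \<psi> v *s \<beta>" for v
  proof -
    have "Z v = bmat w *v S (bmat (word_inv w) *v v)"
      by (simp only: Z_def S_def z_def w_def[symmetric] bmat_append bmat_gen matrix_vector_mul_assoc matrix_mul_assoc)
    also have "\<dots> = bmat w *v (bmat (word_inv w) *v v) - \<psi> v *s \<beta>"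
      by (simp only: S matrix_vector_mult_diff_distrib matrix_vector_mult_smult \<psi>_def \<beta>_def)
    finally show ?thesis
      by (simp only: matrix_vector_mul_assoc bmat_inv matrix_vector_mul_lid)
  qed
  have x: "\<phi> \<beta> * \<psi> (alpha 2) = x"
    unfolding x_def \<phi>_def \<psi>_def \<beta>_def inv by (simp add: run_correct pairing_def w_def)
  have diff: "bmat (z @ [(2, True)] @ z) *v v - bmat ([(2, True)] @ z @ [(2, True)]) *v v
      = (x - lq * lq) *s (\<phi> v *s alpha 2 - \<psi> v *s \<beta>)" for v :: "'a laurent ^ 4"
  proof -
    have "bmat (z @ [(2, True)] @ z) *v v = Z (S (Z v))"
      "bmat ([(2, True)] @ z @ [(2, True)]) *v v = S (Z (S v))"
      by (simp_all only: bmat_append bmat_gen Z_def S_def matrix_vector_mul_assoc matrix_mul_assoc)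
    then show ?thesis
      using reflections_braid_diff[of \<phi> "alpha 2" "lq * lq" \<psi> \<beta> S Z v, OF \<phi> \<psi> S Z] by (simp add: x)
  qed
  show "(bmat (z @ [(2, True)] @ z) :: 'a laurent ^ 4 ^ 4) = bmat ([(2, True)] @ z @ [(2, True)])" if "x = lq * lq"
    using diff that by (simp add: matrix_eq)
  show "(x - lq * lq) * ((1 + lq * lq)\<^sup>2 - x) = 0"
    if "bmat (z @ [(2, True)] @ z) = (bmat ([(2, True)] @ z @ [(2, True)]) :: 'a laurent ^ 4 ^ 4)"
  proof -
    \<comment> \<open>Evaluating at \<alpha>_2 and then applying \<phi> turns the vector identity
      into a scalar one, by \<phi>(\<alpha>_2) = 1 + q^2.\<close>
    have "(x - lq * lq) *s (\<phi> (alpha 2) *s alpha 2 - \<psi> (alpha 2) *s \<beta>) = 0"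
      using diff[of "alpha 2"] that by simp
    then have "\<phi> ((x - lq * lq) *s (\<phi> (alpha 2) *s alpha 2 - \<psi> (alpha 2) *s \<beta>)) = 0"
      using \<phi>(2)[of 0 "alpha 2"] by simp
    moreover have "\<phi> ((x - lq * lq) *s (\<phi> (alpha 2) *s alpha 2 - \<psi> (alpha 2) *s \<beta>))
        = (x - lq * lq) * ((1 + lq * lq)\<^sup>2 - \<phi> \<beta> * \<psi> (alpha 2))"
      by (simp only: \<phi> power2_eq_square mult.commute)
    ultimately show ?thesis
      by (simp only: x)
  qed
qed

section \<open>Certificates and their verification\<close>

text \<open>With the power $q^{-2n}$ taken out of the product of the two pairings, the lists
  \<open>[0, 1]\<close> and \<open>[1, 2, 1]\<close> stand for the exceptional values $q^2$ and $(1 + q^2)^2$.\<close>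

definition certificate :: "int \<Rightarrow> int list \<Rightarrow> bool" where
  "certificate P ks \<longleftrightarrow>
    (let s = run ks; t = run (rev (map uminus ks));
       c = lmul (form_coeffs s) (form_coeffs t);
       d = \<lambda>xs. ladd c (lneg (replicate (fst s + fst t) 0 @ xs))
     in 0 \<notin> set ks \<and> list_all (\<lambda>a. P dvd a) (d [0, 1])
        \<and> \<not> list_all ((=) 0) (d [0, 1]) \<and> \<not> list_all ((=) 0) (d [1, 2, 1]))"

text \<open>Shifting \<open>xs\<close> by n zeros multiplies it by q^(2n) and so puts it over the
  denominator of the product; the remaining factor q^(-2n) is a unit.\<close>

lemma pairing_product_diff:
  fixes ks :: "int list"
  defines "s \<equiv> run ks" and "t \<equiv> run (rev (map uminus ks))"
  defines "c \<equiv> lmul (form_coeffs s) (form_coeffs t)"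
  shows "pairing ks * pairing (rev (map uminus ks)) - lpol xs
    = (Poly_Mapping.single (-2) 1 ^ (fst s + fst t)
        * lpol (ladd c (lneg (replicate (fst s + fst t) 0 @ xs))) :: 'a::comm_ring_1 laurent)"
proof -
  define n where "n = fst s + fst t"
  define R where "R = (Poly_Mapping.single (-2) 1 :: 'a laurent)"
  have pow: "R ^ n * (lq * lq) ^ n = 1"
    by (simp only: R_def power_mult_distrib[symmetric] lq_inverse power_one)
  have "pairing ks * pairing (rev (map uminus ks)) = R ^ n * lpol c"
    unfolding pairing_def root_form_vec_of lpol_lmul c_def n_def s_def t_def power_add R_def
    by (simp only: ac_simps)
  moreover have "R ^ n * lpol (ladd c (lneg (replicate n 0 @ xs)))
      = R ^ n * lpol c - (R ^ n * (lq * lq) ^ n) * lpol xs"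
    by (simp only: lpol_ladd lpol_lneg lpol_shift distrib_left mult_minus_right mult.assoc diff_conv_add_uminus)
  ultimately show ?thesis
    unfolding pow n_def[symmetric] R_def[symmetric] by simp
qed

text \<open>The two sides of the braid relation between z and \<sigma>_2 are the words with equal
  images over \<open>'a\<close> and different images over the integers.\<close>

lemma kernel_burau_if_certificate:
  assumes cert: "certificate P ks" and P: "(of_int P :: 'a::comm_ring_1) = 0"
  shows "kernel artin_D4 GL4 (burau :: 4 word set \<Rightarrow> 'a laurent ^ 4 ^ 4) \<noteq> {\<one>\<^bsub>artin_D4\<^esub>}"
proof -
  define z where "z = map letter ks @ [(2, True)] @ word_inv (map letter ks)"
  define d where "d xs = ladd (lmul (form_coeffs (run ks)) (form_coeffs (run (rev (map uminus ks)))))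
    (lneg (replicate (fst (run ks) + fst (run (rev (map uminus ks)))) 0 @ xs))" for xs
  have ks: "0 \<notin> set ks" and dvd: "list_all (\<lambda>a. P dvd a) (d [0, 1])"
    and nz: "\<not> list_all ((=) 0) (d [0, 1])" "\<not> list_all ((=) 0) (d [1, 2, 1])"
    using cert unfolding certificate_def Let_def d_def by blast+
  note diff = pairing_product_diff[of ks, folded d_def]
  have "bmat (z @ [(2, True)] @ z) = (bmat ([(2, True)] @ z @ [(2, True)]) :: 'a laurent ^ 4 ^ 4)"
    unfolding z_def
  proof (rule braid_relation_pairing(1)[OF ks])
    have "list_all (\<lambda>a. (of_int a :: 'a) = 0) (d [0, 1])"
      using dvd P by (auto simp: list_all_iff elim!: dvdE)
    then show "pairing ks * pairing (rev (map uminus ks)) = (lq * lq :: 'a laurent)"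
      using diff[of "[0, 1]", where ?'a = 'a] by (simp add: lpol_eq_0)
  qed
  moreover have "bmat (z @ [(2, True)] @ z) \<noteq> (bmat ([(2, True)] @ z @ [(2, True)]) :: int laurent ^ 4 ^ 4)"
  proof
    let ?x = "pairing ks * pairing (rev (map uminus ks)) :: int laurent"
    assume "bmat (z @ [(2, True)] @ z) = (bmat ([(2, True)] @ z @ [(2, True)]) :: int laurent ^ 4 ^ 4)"
    from braid_relation_pairing(2)[OF ks this[unfolded z_def]]
    \<comment> \<open>Integral Laurent polynomials have no zero divisors, so one factor
      vanishes.\<close>
    have "?x - lq * lq = 0 \<or> (1 + lq * lq)\<^sup>2 - ?x = 0"
      by (simp only: mult_eq_0_iff)
    moreover have "lpol [0, 1] = (lq * lq :: int laurent)" "lpol [1, 2, 1] = ((1 + lq * lq)\<^sup>2 :: int laurent)"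
      by (simp_all add: power2_eq_square algebra_simps)
    ultimately have "?x - lpol [0, 1] = 0 \<or> ?x - lpol [1, 2, 1] = 0"
      by auto
    \<comment> \<open>Powers of q^-2 are nonzero, so one of the two list polynomials would vanish,
      against \<open>nz\<close>.\<close>
    moreover have "Poly_Mapping.single (-2) 1 \<noteq> (0 :: int laurent)"
      using lq_inverse[where 'a = int] by auto
    ultimately show False
      unfolding diff using nz by (simp add: lpol_nonzero)
  qed
  ultimately show ?thesis
    by (rule kernel_burau_nontrivial)
qed

text \<open>Each list spells a conjugating word w; the check is pure list arithmetic.\<close>

lemma certificates:
  "certificate 9 [-1, -1, -3, -3, -4, 2, -1, -4, -2, -4, 3, -2, -2, -4, -4, -1, -1]"
  "certificate 10 [1, 3, -2, 4, 2, 2, -1, -3, -2, 4, 4, -2, 4, 1, 1, 2, -3]"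
  "certificate 11 [-1, 2, 4, -2, 3, 3, 4, 2, -3, 2, 1, 4, 3, 4, -2, -4, -4, -1, -1, -2, 3, 1]"
  "certificate 12 [-1, -3, -4, 2, -1, -4, 3, 2, -1, -3, -3, -4, -2, 3, -2, 4, 1, 2, -3]"
  "certificate 13 [1, -2, -3, 4, -2, -2, -1, -1, 2, -3, -3, 1, 4, 3, -2, -1, 2, 4, 3, -2, 1, 2, 2,
     1, 1, 1, 1, 3, 4, 2, -3, 1, 1, 2, -4]"
  "certificate 14 [3, -2, -2, 1, 4, 2, -3, -2, 1, -2, -1, 3, 4, -2, -4, -4, -3, 2, -3, -1, -2, 4]"
  "certificate 15 [-1, 3, -4, 2, 2, -1, -4, -2, -4, -3, -1, 2, 4, 1, 2, -1, -4, -1, -2, -3, 4, -2,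
     1, -2, -4, 3, 3, 3, 1, 1]"
  "certificate 16 [1, 1, -3, 4, 4, -2, 3, -2, -1, -4, -3, -3, 2, 1, 4, -2, 3, -2, -2, -4, -3, -1]"
  by code_simp+

theorem theorem6p4:
  fixes p :: nat
  assumes "2 \<le> p" and "p \<le> 16" and "CARD('p::nontriv) = p"
  shows "kernel artin_D4 GL4 (burau :: 4 word set \<Rightarrow> 'p mod_ring laurent ^ 4 ^ 4) \<noteq> {\<one>\<^bsub>artin_D4\<^esub>}"
proof -
  \<comment> \<open>Each p up to 8 has a multiple between 9 and 16, so eight certificates
    suffice.\<close>
  have "list_all (\<lambda>p. list_ex ((dvd) p) [9, 10, 11, 12, 13, 14, 15, 16 :: nat]) [2..<17]"
    by code_simp
  moreover have "p \<in> set [2..<17]"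
    using assms(1,2) unfolding set_upt atLeastLessThan_iff by linarith
  ultimately have "\<exists>P\<in>{9, 10, 11, 12, 13, 14, 15, 16}. p dvd P"
    unfolding list_all_iff list_ex_iff list.set by (rule bspec)
  then obtain P where P: "p dvd P" "P \<in> {9, 10, 11, 12, 13, 14, 15, 16}"
    by blast
  have "\<forall>P\<in>{9, 10, 11, 12, 13, 14, 15, 16}. \<exists>ks. certificate (int P) ks"
    unfolding ball_simps of_nat_numeral by (intro conjI TrueI exI) (rule certificates)+
  then obtain ks where "certificate (int P) ks"
    using P(2) by blast
  \<comment> \<open>P is a multiple of p, the number of elements of the ring, hence zero in
    it.\<close>
  moreover have "(of_int (int P) :: 'p mod_ring) = 0"
  proof -
    obtain k where "P = CARD('p) * k"
      using P(1) assms(3) by (metis dvdE)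
    then show ?thesis
      by (simp only: of_nat_mult of_int_mult of_int_of_nat_eq of_nat_card_eq_0 mult_zero_left)
  qed
  ultimately show ?thesis
    by (rule kernel_burau_if_certificate)
qed

end
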